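(* Let $f\in\mathbb{A}^2(\mathbf{D})$ and let $(a_1,\dots,a_n,\dots)$ be a sequence in $\mathbf{D}$ obtained by consecutive maximal selections for $f$, i.e. for every $n\ge1$, $$|\langle f,B_n^{a_n}\rangle|^2=\sup\{|\langle f,B_n^b\rangle|^2:\ b\in\mathbf{D}\},$$ where for $b\in\mathbf{D}$, $(B_1,\dots,B_{n-1},B_n^b)$ is the Gram–Schmidt orthonormalization of the generalized reproducing kernels $(\tilde k_{a_1},\dots,\tilde k_{a_{n-1}},\tilde k_b)$ associated with the tuple $(a_1,\dots,a_{n-1},b)$, and $B_n=B_n^{a_n}$. Then $$f=\sum_{k=1}^\infty\langle f,B_k\rangle B_k,$$ with convergence in the norm of $\mathbb{A}^2(\mathbf{D})$.
   Context: $\mathbf{D}$ is the open unit disc. $\mathbb{A}^2(\mathbf{D})$ is the Hilbert space of holomorphic functions $f$ on $\mathbf{D}$ with $\|f\|^2=\int_{\mathbf{D}}|f|^2\,dA<\infty$, $dA=dx\,dy/\pi$, with inner product $\langle f,g\rangle=\int_{\mathbf{D}}f\overline g\,dA$. Its reproducing kernel is $k_w(z)=\frac{1}{(1-\overline w z)^2}$. For a tuple $(a_1,\dots,a_n)$ of points of $\mathbf{D}$ (repetitions allowed), $l(a_j)$ is the number of times the value $a_j$ occurs in $(a_1,\dots,a_j)$, and the generalized reproducing kernels associated with the tuple are $\tilde k_{a_j}(z)=\left(\frac{d}{d\overline w}\right)^{l(a_j)-1}k_w(z)\big|_{w=a_j}$. *)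

theory Defs
  imports "HOL-Complex_Analysis.Complex_Analysis"
begin

abbreviation unit_disc :: "complex set" where
  "unit_disc \<equiv> ball 0 1"

text \<open>The Bergman space of the disc. Its elements are represented by functions on all of
  \<^typ>\<open>complex\<close>; their values outside the disc play no role. The factor \<open>1 / pi\<close> below is the
  normalisation of the area measure \<open>dA = dx dy / pi\<close>.\<close>

definition bergman_space :: "(complex \<Rightarrow> complex) set" where
  "bergman_space =
     {f. f holomorphic_on unit_disc \<and> set_integrable lborel unit_disc (\<lambda>z. (cmod (f z))\<^sup>2)}"

definition bergman_inner :: "(complex \<Rightarrow> complex) \<Rightarrow> (complex \<Rightarrow> complex) \<Rightarrow> complex" where
  "bergman_inner f g = (1 / complex_of_real pi) * (LINT z:unit_disc|lborel. f z * cnj (g z))"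

definition bergman_norm :: "(complex \<Rightarrow> complex) \<Rightarrow> real" where
  "bergman_norm f = sqrt ((1 / pi) * (LINT z:unit_disc|lborel. (cmod (f z))\<^sup>2))"

definition bergman_kernel :: "complex \<Rightarrow> complex \<Rightarrow> complex" where
  "bergman_kernel w z = 1 / (1 - cnj w * z)\<^sup>2"

text \<open>The Wirtinger derivative with respect to the conjugate variable,
  \<open>(d/dx + i d/dy) / 2\<close>, written with the real Frechet derivative in the directions
  \<open>1\<close> and \<open>i\<close>.\<close>

definition dbar :: "(complex \<Rightarrow> complex) \<Rightarrow> complex \<Rightarrow> complex" where
  "dbar g w = (frechet_derivative g (at w) 1 + \<i> * frechet_derivative g (at w) \<i>) / 2"

text \<open>Tuples and sequences are indexed from \<open>1\<close>: an \<open>n\<close>-tuple is given by the values of a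
  function on \<open>{1..n}\<close>, and the value at \<open>0\<close> is never used. The objects attached to index \<open>n\<close>
  only depend on the entries with index in \<open>{1..n}\<close>, so that the entry \<open>n\<close> computed from
  \<open>a(n := b)\<close> is the one computed from the tuple \<open>(a 1, ..., a (n - 1), b)\<close>.\<close>

definition occurrence :: "(nat \<Rightarrow> complex) \<Rightarrow> nat \<Rightarrow> nat" where
  "occurrence a j = card {i \<in> {1..j}. a i = a j}"

definition generalized_kernel :: "(nat \<Rightarrow> complex) \<Rightarrow> nat \<Rightarrow> complex \<Rightarrow> complex" where
  "generalized_kernel a j z =
     (dbar ^^ (occurrence a j - 1)) (\<lambda>w. bergman_kernel w z) (a j)"

definition bergman_normalize :: "(complex \<Rightarrow> complex) \<Rightarrow> complex \<Rightarrow> complex" where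
  "bergman_normalize g = (\<lambda>z. g z / complex_of_real (bergman_norm g))"

fun gram_schmidt :: "(nat \<Rightarrow> complex \<Rightarrow> complex) \<Rightarrow> nat \<Rightarrow> (complex \<Rightarrow> complex)" where
  "gram_schmidt K n = bergman_normalize
     (\<lambda>z. K n z - (\<Sum>j = 1..<n. bergman_inner (K n) (gram_schmidt K j) * gram_schmidt K j z))"

declare gram_schmidt.simps [simp del]

definition bergman_basis :: "(nat \<Rightarrow> complex) \<Rightarrow> nat \<Rightarrow> complex \<Rightarrow> complex" where
  "bergman_basis a = gram_schmidt (generalized_kernel a)"

text \<open>The supremum is
  one of a bounded set, since each \<open>bergman_basis (a(n := b)) n\<close> is a unit vector.\<close>

definition consecutive_maximal_selections ::
    "(complex \<Rightarrow> complex) \<Rightarrow> (nat \<Rightarrow> complex) \<Rightarrow> bool" where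
  "consecutive_maximal_selections f a \<longleftrightarrow>
     (\<forall>n\<ge>1. (cmod (bergman_inner f (bergman_basis a n)))\<^sup>2 =
        (SUP b\<in>unit_disc. (cmod (bergman_inner f (bergman_basis (a(n := b)) n)))\<^sup>2))"

end

theory Submission
  imports Defs
begin

text \<open>Write \<open>c\<^sub>k = \<langle>f, B\<^sub>k\<rangle>\<close> and let \<open>f\<^sub>n\<close> be \<open>f\<close> minus its first \<open>n\<close> terms. For \<open>b\<close> not in the sequence, the
  generalized kernel of \<open>b\<close> is \<open>k\<^sub>b\<close> itself; since \<open>B\<^sub>n\<^sup>b\<close> is the normalized residual of \<open>k\<^sub>b\<close>, whose norm
  is at most that of \<open>k\<^sub>b\<close>, the reproducing property and maximality of \<open>a\<^sub>n\<close> give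
  \<open>\<bar>f\<^sub>n\<^sub>-\<^sub>1(b)\<bar> \<le> \<bar>c\<^sub>n\<bar> \<parallel>k\<^sub>b\<parallel>\<close>. By Bessel's inequality \<open>c\<^sub>n\<close> tends to \<open>0\<close>, so \<open>f\<^sub>n\<close> tends to \<open>0\<close> off a countable
  set. Since \<open>\<parallel>f\<^sub>n - f\<^sub>m\<parallel>\<^sup>2\<close> is a tail of \<open>\<Sum>\<bar>c\<^sub>k\<bar>\<^sup>2\<close>, Fatou's lemma turns this pointwise limit into norm
  convergence. The reproducing property is obtained by integrating the product of the power series of
  \<open>g\<close> and \<open>k\<^sub>b\<close> over discs of radius \<open>r < 1\<close>, where monomials are orthogonal by rotation invariance.\<close>

subsection \<open>Linear substitutions in the plane\<close>

text \<open>Carries Lebesgue measure from \<open>real^2\<close> to \<open>complex\<close>, so that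
  the invariance of area under orthogonal maps of \<open>real^2\<close> applies to rotations of the
  complex plane. It is enough to compare boxes, and the coordinates match boxes with boxes of equal
  sides.\<close>

lemma lborel_complex_eq_distr:
  "distr (lborel :: (real^2) measure) borel (\<lambda>v. Complex (v $ 1) (v $ 2)) = lborel"
proof (rule lborel_eqI[symmetric])
  have meas [measurable]: "(\<lambda>v::real^2. Complex (v $ 1) (v $ 2)) \<in> borel \<rightarrow>\<^sub>M borel"
    by (intro borel_measurable_continuous_onI) (simp add: Complex_eq, intro continuous_intros)
  fix l u :: complex
  assume le: "\<And>b. b \<in> Basis \<Longrightarrow> l \<bullet> b \<le> u \<bullet> b"
  have "(\<lambda>v::real^2. Complex (v $ 1) (v $ 2)) -` box l u
      = box (vector [Re l, Im l]) (vector [Re u, Im u])"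
    by (auto simp: box_def Basis_complex_def Basis_vec_def axis_eq_axis inner_axis forall_2)
  then show "emeasure (distr lborel borel (\<lambda>v::real^2. Complex (v $ 1) (v $ 2))) (box l u)
      = (\<Prod>b\<in>Basis. (u - l) \<bullet> b)"
    using le[of 1] le[of \<i>]
    by (simp add: emeasure_distr emeasure_lborel_box_eq Basis_complex_def Basis_vec_def
        axis_eq_axis inner_axis UNIV_2 forall_2)
qed simp

text \<open>A box pulled back by multiplication with \<open>\<alpha>\<close> is, in the coordinates
  of \<open>real^2\<close>, a box pushed forward by an orthogonal map, which keeps its area.\<close>

lemma lborel_distr_rotate:
  fixes \<alpha> :: complex
  assumes "cmod \<alpha> = 1"
  shows "distr lborel borel ((*) \<alpha>) = lborel"
proof (rule lborel_eqI[symmetric])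
  define T where "T = (\<lambda>v::real^2. Complex (v $ 1) (v $ 2))"
  define T' where "T' = (\<lambda>z. vector [Re z, Im z] :: real^2)"
  \<comment> \<open>\<open>cnj \<alpha>\<close> is the inverse of \<open>\<alpha>\<close>, so images
    under \<open>R\<close> correspond to preimages under multiplication by
    \<open>\<alpha>\<close>.\<close>
  define R where "R = (\<lambda>v. T' (cnj \<alpha> * T v))"
  have T_meas [measurable]: "T \<in> borel \<rightarrow>\<^sub>M borel"
    unfolding T_def
    by (intro borel_measurable_continuous_onI) (simp add: Complex_eq, intro continuous_intros)
  have TT' [simp]: "T (T' z) = z" "T' (T v) = v" for z v
    by (auto simp: T_def T'_def vec_eq_iff forall_2)
  have norm_T: "norm (T v) = norm v" for v
    by (simp add: T_def cmod_def norm_vec_def L2_set_def UNIV_2)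
  have norm_T': "norm (T' z) = norm z" for z
    by (metis TT'(1) norm_T)
  have "linear R"
    by (rule linearI) (auto simp: R_def T_def T'_def vec_eq_iff forall_2 algebra_simps)
  then have R: "orthogonal_transformation R"
    using assms by (simp add: orthogonal_transformation norm_T norm_T' R_def norm_mult)
  fix l u :: complex
  assume le: "\<And>b. b \<in> Basis \<Longrightarrow> l \<bullet> b \<le> u \<bullet> b"
  have meas_mult: "(*) \<alpha> \<in> borel_measurable borel"
    by simp
  have conj1: "cnj \<alpha> * \<alpha> = 1" "\<alpha> * cnj \<alpha> = 1"
    using assms by (simp_all add: complex_norm_square[symmetric] mult.commute)
  have pre: "T -` ((*) \<alpha> -` box l u) = R ` (T -` box l u)"
  proof (intro set_eqI iffI)
    fix v assume "v \<in> T -` ((*) \<alpha> -` box l u)"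
    moreover have "v = R (T' (\<alpha> * T v))"
      using conj1 by (simp add: R_def mult.assoc[symmetric])
    ultimately show "v \<in> R ` (T -` box l u)" by (metis TT'(1) imageI vimageE vimageI2)
  next
    fix v assume "v \<in> R ` (T -` box l u)"
    then show "v \<in> T -` ((*) \<alpha> -` box l u)"
      using conj1 by (auto simp: R_def mult.assoc[symmetric])
  qed
  have box: "T -` box l u = box (T' l) (T' u)"
    by (auto simp: T_def T'_def box_def Basis_complex_def Basis_vec_def axis_eq_axis inner_axis forall_2)
  have "emeasure (distr lborel borel ((*) \<alpha>)) (box l u) = emeasure lborel ((*) \<alpha> -` box l u)"
    by (simp add: emeasure_distr)
  also have "\<dots> = emeasure lborel (R ` box (T' l) (T' u))"
    by (subst lborel_complex_eq_distr[folded T_def, symmetric])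
      (simp add: emeasure_distr pre box[symmetric] measurable_sets_borel[OF meas_mult])
  \<comment> \<open>Both measures agree on Borel sets, and the image is Borel because by
    \<open>pre\<close> it is the preimage of a box under a measurable map.\<close>
  also have "\<dots> = emeasure lebesgue (R ` box (T' l) (T' u))"
    using measurable_sets[of "\<lambda>v. \<alpha> * T v" borel borel "box l u"] pre box
    by (simp add: vimage_comp o_def)
  also have "\<dots> = measure lebesgue (R ` box (T' l) (T' u))"
    by (rule emeasure_eq_measure2)
      (use measurable_orthogonal_image[OF R, of "box (T' l) (T' u)"] in auto)
  also have "\<dots> = measure lebesgue (box (T' l) (T' u))"
    by (simp add: measure_orthogonal_image[OF R])
  also have "\<dots> = (\<Prod>b\<in>Basis. (u - l) \<bullet> b)"
    using le[of 1] le[of \<i>]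
    by (simp add: measure_lborel_box_eq Basis_complex_def Basis_vec_def T'_def
        axis_eq_axis inner_axis UNIV_2 forall_2)
  finally show "emeasure (distr lborel borel ((*) \<alpha>)) (box l u) = (\<Prod>b\<in>Basis. (u - l) \<bullet> b)" .
qed simp

lemma integral_complex_rotate:
  fixes F :: "complex \<Rightarrow> complex"
  assumes "F \<in> borel_measurable borel" "cmod \<alpha> = 1"
  shows "(LINT z|lborel. F (\<alpha> * z)) = (LINT z|lborel. F z)"
  using integral_distr[of "(*) \<alpha>" lborel borel F] assms
  by (simp add: lborel_distr_rotate)

lemma integral_complex_scale:
  fixes F :: "complex \<Rightarrow> real"
  assumes "F \<in> borel_measurable borel" "c > 0"
  shows "(LINT z|lborel. F z) = c\<^sup>2 * (LINT z|lborel. F (c *\<^sub>R z))"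
proof -
  have "(LINT z|lborel. F z) = (LINT z|density (distr lborel borel (\<lambda>x::complex. 0 + c *\<^sub>R x)) (\<lambda>_. \<bar>c\<bar>^DIM(complex)). F z)"
    using lborel_affine[of c "0::complex"] assms by simp
  also have "\<dots> = c\<^sup>2 * (LINT z|lborel. F (c *\<^sub>R z))"
    using assms by (simp add: integral_density integral_distr)
  finally show ?thesis .
qed

subsection \<open>Integrals over discs\<close>

lemma emeasure_lborel_ball_finite:
  "emeasure lborel (ball c r :: complex set) < top"
  using emeasure_bounded_finite[of "ball c r"] by simp

lemma set_integrable_bounded_continuous:
  fixes F :: "complex \<Rightarrow> 'a::{banach, second_countable_topology}"
  assumes "continuous_on (ball c r) F" "\<And>z. z \<in> ball c r \<Longrightarrow> norm (F z) \<le> B"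
  shows "set_integrable lborel (ball c r) F"
  unfolding set_integrable_def
proof (rule Bochner_Integration.integrable_bound)
  show "integrable lborel (\<lambda>z. indicator (ball c r) z *\<^sub>R B)"
    by (rule integrable_indicator) (auto intro!: emeasure_lborel_ball_finite)
  show "(\<lambda>z. indicator (ball c r) z *\<^sub>R F z) \<in> borel_measurable lborel"
    using borel_measurable_continuous_on_indicator[OF _ assms(1)] by simp
  show "AE z in lborel. norm (indicator (ball c r) z *\<^sub>R F z) \<le> norm (indicator (ball c r) z *\<^sub>R B)"
    using assms(2) by (intro AE_I2) (force simp: indicator_def)
qed

text \<open>Termwise integration by domination: since the ball has finite area, the uniform bounds
  \<open>B n\<close> make the integrals of the norms summable.\<close>

lemma set_integral_sums_bounded:
  fixes G :: "nat \<Rightarrow> complex \<Rightarrow> complex"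
  assumes cont: "\<And>n. continuous_on (ball c r) (G n)"
    and bound: "\<And>n z. z \<in> ball c r \<Longrightarrow> norm (G n z) \<le> B n"
    and B: "summable B"
    and sums: "\<And>z. z \<in> ball c r \<Longrightarrow> (\<lambda>n. G n z) sums F z"
  shows "(\<lambda>n. LINT z:ball c r|lborel. G n z) sums (LINT z:ball c r|lborel. F z)"
proof -
  let ?G = "\<lambda>n z. indicator (ball c r) z *\<^sub>R G n z"
  have integrable: "integrable lborel (?G n)" for n
    using set_integrable_bounded_continuous[OF cont bound] by (simp add: set_integrable_def)
  have bound': "norm (?G n z) \<le> indicator (ball c r) z * B n" for n z
    using bound by (auto simp: indicator_def)
  have "summable (\<lambda>n. norm (?G n z))" for z
    by (rule summable_comparison_test'[OF summable_mult[OF B]]) (use bound' in auto)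
  moreover have "summable (\<lambda>n. LINT z|lborel. norm (?G n z))"
  proof (rule summable_comparison_test'[OF summable_mult[OF B]])
    fix n :: nat
    have "(LINT z|lborel. norm (?G n z)) \<le> (LINT z|lborel. indicator (ball c r) z * B n)"
      by (rule integral_mono[OF integrable_norm[OF integrable] _ bound'])
        (auto intro!: emeasure_lborel_ball_finite)
    then show "norm (LINT z|lborel. norm (?G n z)) \<le> measure lborel (ball c r) * B n"
      by simp
  qed
  ultimately have "(\<lambda>n. LINT z|lborel. ?G n z) sums (LINT z|lborel. (\<Sum>n. ?G n z))"
    by (intro sums_integral integrable) auto
  moreover have "(\<Sum>n. ?G n z) = indicator (ball c r) z *\<^sub>R F z" for z
    using sums[of z] by (auto simp: indicator_def sums_iff)
  ultimately show ?thesis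
    by (simp add: set_lebesgue_integral_def)
qed

lemma measure_complex_ball:
  "r \<ge> 0 \<Longrightarrow> measure lborel (ball (c::complex) r) = pi * r\<^sup>2"
  using content_ball[of r c] by (simp add: unit_ball_vol_2)

lemma disc_moment_scale:
  assumes "s > 0"
  shows "(LINT z:ball (0::complex) s|lborel. cmod z ^ (2 * n))
    = s ^ (2 * n + 2) * (LINT z:ball (0::complex) 1|lborel. cmod z ^ (2 * n))"
proof -
  have "(LINT z:ball (0::complex) s|lborel. cmod z ^ (2 * n))
      = s\<^sup>2 * (LINT z|lborel. indicator (ball (0::complex) s) (s *\<^sub>R z) *\<^sub>R cmod (s *\<^sub>R z) ^ (2 * n))"
    unfolding set_lebesgue_integral_def
    by (rule integral_complex_scale[OF borel_measurable_continuous_on_indicator assms])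
      (auto intro!: continuous_intros)
  also have "(\<lambda>z. indicator (ball (0::complex) s) (s *\<^sub>R z) *\<^sub>R cmod (s *\<^sub>R z) ^ (2 * n))
     = (\<lambda>z. s ^ (2 * n) * (indicator (ball 0 1) z *\<^sub>R cmod z ^ (2 * n)))"
    using assms by (auto simp: indicator_def fun_eq_iff power_mult_distrib)
  finally show ?thesis
    by (simp add: set_lebesgue_integral_def power_add power2_eq_square)
qed

text \<open>By scaling, the integral \<open>J\<close> satisfies
  \<open>s\<^sup>2\<^sup>n \<pi> (1 - s\<^sup>2) \<le> (1 - s\<^sup>2\<^sup>n\<^sup>+\<^sup>2) J \<le> \<pi> (1 - s\<^sup>2)\<close>, comparing the integrand with its extreme values on the annulus
  between the radii \<open>s\<close> and \<open>1\<close>. Dividing by \<open>1 - s\<^sup>2\<close> and letting \<open>s\<close> tend to \<open>1\<close> avoids polar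
  coordinates.\<close>

lemma disc_moment_unit:
  "(LINT z:ball (0::complex) 1|lborel. cmod z ^ (2 * n)) = pi / (real n + 1)"
proof -
  let ?J = "\<lambda>r. LINT z:ball (0::complex) r|lborel. cmod z ^ (2 * n)"
  have int: "set_integrable lborel (ball 0 r) (\<lambda>z::complex. cmod z ^ (2 * n))" for r
    by (rule set_integrable_bounded_continuous[where B = "r ^ (2 * n)"])
      (auto intro!: continuous_intros power_mono)
  \<comment> \<open>The factor \<open>1 - s\<^sup>2\<close>, proportional to the area of the
    annulus, will cancel; the remaining finite sum tends to \<open>n + 1\<close> as \<open>s\<close>
    tends to \<open>1\<close>.\<close>
  have geo: "1 - s ^ (2 * n + 2) = (1 - s\<^sup>2) * (\<Sum>k\<le>n. (s\<^sup>2) ^ k)" for s :: real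
    using one_diff_power_eq[of "s\<^sup>2" "Suc n"] power_mult[of s 2 "Suc n"]
    by (simp only: lessThan_Suc_atMost) simp
  have bounds: "s ^ (2 * n) * pi \<le> ?J 1 * (\<Sum>k\<le>n. (s\<^sup>2) ^ k) \<and> ?J 1 * (\<Sum>k\<le>n. (s\<^sup>2) ^ k) \<le> pi"
    if s: "0 < s" "s < 1" for s
  proof -
    let ?A = "ball (0::complex) 1 - ball 0 s"
    have sub: "ball (0::complex) s \<subseteq> ball 0 1" using s by auto
    have mA: "measure lborel ?A = pi * (1 - s\<^sup>2)"
      using s sub emeasure_lborel_ball_finite[of 0 1]
      by (subst measure_Diff) (simp_all add: measure_complex_ball algebra_simps)
    have finA: "emeasure lborel ?A < top"
      by (rule le_less_trans[OF emeasure_mono emeasure_lborel_ball_finite[of 0 1]]) auto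
    have intA: "set_integrable lborel ?A (\<lambda>z::complex. cmod z ^ (2 * n))"
      by (rule set_integrable_subset[OF int[of 1]]) auto
    have "?J 1 = ?J s + (LINT z:?A|lborel. cmod z ^ (2 * n))"
      using set_integral_Un[OF _ int[of s] intA] sub by (simp add: Un_absorb1)
    then have "(LINT z:?A|lborel. cmod z ^ (2 * n)) = ?J 1 - s ^ (2 * n + 2) * ?J 1"
      using disc_moment_scale[OF s(1), of n] by linarith
    also have "\<dots> = (1 - s ^ (2 * n + 2)) * ?J 1"
      by (simp only: left_diff_distrib mult_1)
    also have "\<dots> = (1 - s\<^sup>2) * (?J 1 * (\<Sum>k\<le>n. (s\<^sup>2) ^ k))"
      unfolding geo by (simp only: mult_ac)
    finally have eq: "(LINT z:?A|lborel. cmod z ^ (2 * n)) = \<dots>" .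
    have const: "set_integrable lborel ?A (\<lambda>z. C)" "(LINT z:?A|lborel. C) = C * (pi * (1 - s\<^sup>2))" for C :: real
      using finA mA by (simp_all add: set_integrable_def set_lebesgue_integral_def)
    have "(LINT z:?A|lborel. s ^ (2 * n)) \<le> (LINT z:?A|lborel. cmod z ^ (2 * n))"
      by (rule set_integral_mono[OF const(1) intA]) (use s in \<open>auto intro: power_mono\<close>)
    then have 1: "(1 - s\<^sup>2) * (s ^ (2 * n) * pi) \<le> (1 - s\<^sup>2) * (?J 1 * (\<Sum>k\<le>n. (s\<^sup>2) ^ k))"
      unfolding const eq by (simp only: mult_ac)
    have "(LINT z:?A|lborel. cmod z ^ (2 * n)) \<le> (LINT z:?A|lborel. 1)"
      by (rule set_integral_mono[OF intA const(1)]) (use s in \<open>auto intro: power_le_one\<close>)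
    then have 2: "(1 - s\<^sup>2) * (?J 1 * (\<Sum>k\<le>n. (s\<^sup>2) ^ k)) \<le> (1 - s\<^sup>2) * pi"
      unfolding const eq by (simp only: mult_ac mult_1)
    have "1 - s\<^sup>2 > 0"
      using s by (simp add: power_less_one_iff)
    with 1 2 show ?thesis by (simp only: mult_le_cancel_left_pos)
  qed
  have ev: "\<forall>\<^sub>F s in at_left 1. 0 < s \<and> s < (1::real)"
    using eventually_at_left_real[of 0 "1::real"] by (auto elim: eventually_mono)
  have lim: "((\<lambda>s. ?J 1 * (\<Sum>k\<le>n. (s\<^sup>2) ^ k)) \<longlongrightarrow> ?J 1 * (\<Sum>k\<le>n. (1\<^sup>2) ^ k)) (at_left 1)"
    by (intro tendsto_intros)
  have "((\<lambda>s. ?J 1 * (\<Sum>k\<le>n. (s\<^sup>2) ^ k)) \<longlongrightarrow> pi) (at_left 1)"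
  proof (rule tendsto_sandwich)
    have "((\<lambda>s. s ^ (2 * n) * pi) \<longlongrightarrow> 1 ^ (2 * n) * pi) (at_left 1)"
      by (intro tendsto_intros)
    then show "((\<lambda>s. s ^ (2 * n) * pi) \<longlongrightarrow> pi) (at_left 1)" by simp
    show "((\<lambda>s. pi) \<longlongrightarrow> pi) (at_left 1)" by simp
  qed (use bounds ev in \<open>auto elim!: eventually_mono\<close>)
  with lim have "?J 1 * (\<Sum>k\<le>n. (1\<^sup>2) ^ k) = pi"
    by (rule tendsto_unique[rotated]) simp
  then show ?thesis by (simp add: field_simps)
qed

lemma disc_moment:
  assumes "r > 0"
  shows "(LINT z:ball (0::complex) r|lborel. cmod z ^ (2 * n)) = pi * r ^ (2 * n + 2) / (real n + 1)"
  by (subst disc_moment_scale[OF assms]) (simp add: disc_moment_unit)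

section \<open>Orthogonality of monomials, and integrals against the kernel over smaller
  discs\<close>

lemma disc_monomial_offdiag:
  assumes "m \<noteq> n"
  shows "(LINT z:ball 0 r|lborel. z ^ m * cnj z ^ n) = 0"
proof -
  \<comment> \<open>Rotation by \<open>\<theta>\<close> multiplies \<open>z ^ m * cnj z ^ n\<close>
    by \<open>cis ((real m - real n) * \<theta>)\<close>. This angle makes the factor
    \<open>-1\<close>, so the integral equals its own negative.\<close>
  define \<theta> where "\<theta> = pi / (real m - real n)"
  let ?F = "\<lambda>z. indicator (ball 0 r) z *\<^sub>R (z ^ m * cnj z ^ n)"
  have "cis \<theta> ^ m * cnj (cis \<theta>) ^ n = cis (real m * \<theta> - real n * \<theta>)"
    by (simp add: cis_cnj Complex.DeMoivre cis_mult)
  also have "real m * \<theta> - real n * \<theta> = (real m - real n) * \<theta>"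
    by (rule left_diff_distrib[symmetric])
  also have "\<dots> = pi"
    using assms by (simp add: \<theta>_def)
  finally have rot: "cis \<theta> ^ m * cnj (cis \<theta>) ^ n = -1" by simp
  have "?F (cis \<theta> * z) = - ?F z" for z
  proof -
    have "(cis \<theta> * z) ^ m * cnj (cis \<theta> * z) ^ n = (cis \<theta> ^ m * cnj (cis \<theta>) ^ n) * (z ^ m * cnj z ^ n)"
      by (simp add: power_mult_distrib mult_ac)
    then show ?thesis
      by (simp add: rot indicator_def norm_mult)
  qed
  moreover have "?F \<in> borel_measurable borel"
    by (rule borel_measurable_continuous_on_indicator) (auto intro!: continuous_intros)
  ultimately have "(LINT z|lborel. ?F z) = (LINT z|lborel. - ?F z)"
    using integral_complex_rotate[of ?F "cis \<theta>"] by simp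
  then show ?thesis
    by (simp add: set_lebesgue_integral_def)
qed

lemma disc_monomial_diag:
  assumes "r > 0"
  shows "(LINT z:ball 0 r|lborel. z ^ n * cnj z ^ n) = complex_of_real (pi * r ^ (2 * n + 2) / (real n + 1))"
proof -
  have "z ^ n * cnj z ^ n = complex_of_real (cmod z ^ (2 * n))" for z
    by (metis complex_norm_square of_real_power power_mult power_mult_distrib)
  then have "(LINT z:ball 0 r|lborel. z ^ n * cnj z ^ n)
     = (LINT z:ball 0 r|lborel. complex_of_real (cmod z ^ (2 * n)))"
    by simp
  also have "\<dots> = complex_of_real (LINT z:ball (0::complex) r|lborel. cmod z ^ (2 * n))"
    by (rule set_integral_complex_of_real)
  finally show ?thesis by (simp only: disc_moment[OF assms])
qed

text \<open>When the Taylor series of \<open>g\<close> at \<open>0\<close> is integrated term by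
  term, orthogonality of the monomials leaves only the term of degree \<open>n\<close>.\<close>

lemma integral_holomorphic_cnj_monomial:
  assumes holo: "g holomorphic_on ball 0 1" and r: "0 < r" "r < 1"
  shows "(LINT z:ball 0 r|lborel. g z * cnj z ^ n)
    = (deriv ^^ n) g 0 / fact n * complex_of_real (pi * r ^ (2 * n + 2) / (real n + 1))"
proof -
  define c where "c m = (deriv ^^ m) g 0 / fact m" for m
  have series: "(\<lambda>m. c m * z ^ m) sums g z" if "cmod z < 1" for z
    using holomorphic_power_series[OF holo, of z] that by (simp add: c_def)
  have "(\<lambda>m. LINT z:ball 0 r|lborel. c m * z ^ m * cnj z ^ n) sums (LINT z:ball 0 r|lborel. g z * cnj z ^ n)"
  proof (rule set_integral_sums_bounded)
    \<comment> \<open>Convergence at a slightly larger radius \<open>r'\<close> gives absolute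
      convergence at \<open>r\<close>, hence summable bounds valid on the whole disc of radius
      \<open>r\<close>.\<close>
    obtain r' where r': "r < r'" "r' < 1" using r dense by blast
    have "summable (\<lambda>m. norm (c m * complex_of_real r ^ m))"
      using series[of "complex_of_real r'"] r r'
      by (intro powser_insidea[of c "complex_of_real r'"]) (auto simp: sums_iff)
    then show "summable (\<lambda>m. norm (c m * complex_of_real r ^ m))" .
    fix m :: nat and z :: complex assume z: "z \<in> ball 0 r"
    have "cmod z ^ m * cmod z ^ n \<le> r ^ m * 1"
      using z r by (intro mult_mono power_mono power_le_one) auto
    then show "norm (c m * z ^ m * cnj z ^ n) \<le> norm (c m * complex_of_real r ^ m)"
      using r by (auto simp: norm_mult norm_power mult.assoc intro!: mult_left_mono)
  qed (use series r in \<open>auto intro!: continuous_intros sums_mult2\<close>)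
  moreover have "(LINT z:ball 0 r|lborel. c m * z ^ m * cnj z ^ n)
      = (if m = n then c n * complex_of_real (pi * r ^ (2 * n + 2) / (real n + 1)) else 0)" for m
    using disc_monomial_offdiag[of m n r] disc_monomial_diag[OF r(1), of n]
    by (simp add: mult.assoc)
  ultimately have "(\<lambda>m. if m = n then c n * complex_of_real (pi * r ^ (2 * n + 2) / (real n + 1)) else 0)
      sums (LINT z:ball 0 r|lborel. g z * cnj z ^ n)"
    by simp
  moreover have "(\<lambda>m. if m = n then c n * complex_of_real (pi * r ^ (2 * n + 2) / (real n + 1)) else 0)
      sums (c n * complex_of_real (pi * r ^ (2 * n + 2) / (real n + 1)))"
    by (rule sums_single)
  ultimately show ?thesis
    unfolding c_def by (rule sums_unique2)
qed

text \<open>The conjugate kernel is the sum of \<open>(n + 1) * b ^ n * cnj z ^ n\<close>. Its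
  factor \<open>n + 1\<close> cancels the denominator of the moment, and what remains is the Taylor
  series of \<open>g\<close> at \<open>0\<close>, evaluated at \<open>r\<^sup>2 * b\<close>.\<close>

lemma integral_holomorphic_kernel:
  assumes holo: "g holomorphic_on ball 0 1" and r: "0 < r" "r < 1" and b: "cmod b < 1"
  shows "(LINT z:ball 0 r|lborel. g z * cnj (bergman_kernel b z))
    = complex_of_real (pi * r\<^sup>2) * g (complex_of_real (r\<^sup>2) * b)"
proof -
  define c where "c m = (deriv ^^ m) g 0 / fact m" for m
  have series: "(\<lambda>m. c m * z ^ m) sums g z" if "cmod z < 1" for z
    using holomorphic_power_series[OF holo, of z] that by (simp add: c_def)
  have cont: "continuous_on (ball 0 1) g"
    by (rule holomorphic_on_imp_continuous_on[OF holo])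
  \<comment> \<open>\<open>g\<close> may be unbounded near the unit circle; compactness bounds it on
    the closed disc of radius \<open>r < 1\<close>, which gives the dominating series.\<close>
  have "compact (g ` cball 0 r)"
    using r by (intro compact_continuous_image continuous_on_subset[OF cont]) auto
  then obtain M where "\<forall>x\<in>g ` cball 0 r. norm x \<le> M"
    by (meson bounded_iff compact_imp_bounded)
  then have M: "cmod (g z) \<le> M" if "cmod z < r" for z
    using that by (auto simp: image_iff)
  have geo: "summable (\<lambda>n. real (Suc n) * cmod b ^ n)"
    using geometric_deriv_sums[of "cmod b"] b by (auto simp: sums_iff)
  have "(\<lambda>n. LINT z:ball 0 r|lborel. of_nat (Suc n) * b ^ n * (g z * cnj z ^ n))
      sums (LINT z:ball 0 r|lborel. g z * cnj (bergman_kernel b z))"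
  proof (rule set_integral_sums_bounded)
    show "continuous_on (ball 0 r) (\<lambda>z. of_nat (Suc n) * b ^ n * (g z * cnj z ^ n))" for n
      using r by (intro continuous_intros continuous_on_subset[OF cont]) auto
    show "summable (\<lambda>n. M * (real (Suc n) * cmod b ^ n))"
      by (rule summable_mult[OF geo])
    fix z :: complex assume z: "z \<in> ball 0 r"
    show "norm (of_nat (Suc n) * b ^ n * (g z * cnj z ^ n)) \<le> M * (real (Suc n) * cmod b ^ n)" for n
    proof -
      have "cmod (g z) * cmod z ^ n \<le> M * 1"
        using z r M[of z] order_trans[OF norm_ge_zero M[of z]] by (intro mult_mono power_le_one) auto
      then have "real (Suc n) * cmod b ^ n * (cmod (g z) * cmod z ^ n) \<le> real (Suc n) * cmod b ^ n * M"
        by (intro mult_left_mono) auto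
      then show ?thesis
        by (simp add: norm_mult norm_power mult_ac del: of_nat_Suc)
    qed
    have "cmod (b * cnj z) < 1"
    proof -
      have "cmod b * cmod z \<le> cmod b * 1" using z r by (intro mult_left_mono) auto
      with b show ?thesis by (simp add: norm_mult norm_power)
    qed
    from sums_mult[OF geometric_deriv_sums[OF this], of "g z"]
    show "(\<lambda>n. of_nat (Suc n) * b ^ n * (g z * cnj z ^ n)) sums (g z * cnj (bergman_kernel b z))"
      by (simp add: bergman_kernel_def power_mult_distrib mult_ac)
  qed
  moreover have "(LINT z:ball 0 r|lborel. of_nat (Suc n) * b ^ n * (g z * cnj z ^ n))
     = complex_of_real (pi * r\<^sup>2) * (c n * (complex_of_real (r\<^sup>2) * b) ^ n)" for n
  proof -
    have "(LINT z:ball 0 r|lborel. of_nat (Suc n) * b ^ n * (g z * cnj z ^ n))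
      = of_nat (Suc n) * b ^ n * (c n * complex_of_real (pi * r ^ (2 * n + 2) / (real n + 1)))"
      using integral_holomorphic_cnj_monomial[OF holo r, of n] by (simp add: c_def)
    also have "complex_of_real (pi * r ^ (2 * n + 2) / (real n + 1))
       = complex_of_real (pi * r\<^sup>2) * complex_of_real (r\<^sup>2) ^ n / of_nat (Suc n)"
      by (simp add: power_add power_mult add.commute power2_eq_square)
    finally show ?thesis
      by (simp add: power_mult_distrib mult_ac del: of_nat_Suc)
  qed
  ultimately have "(\<lambda>n. complex_of_real (pi * r\<^sup>2) * (c n * (complex_of_real (r\<^sup>2) * b) ^ n))
      sums (LINT z:ball 0 r|lborel. g z * cnj (bergman_kernel b z))"
    by simp
  moreover have "(\<lambda>n. complex_of_real (pi * r\<^sup>2) * (c n * (complex_of_real (r\<^sup>2) * b) ^ n))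
      sums (complex_of_real (pi * r\<^sup>2) * g (complex_of_real (r\<^sup>2) * b))"
  proof -
    have "r\<^sup>2 * cmod b \<le> 1 * cmod b" using r by (intro mult_right_mono power_le_one) auto
    with b show ?thesis by (intro sums_mult series) (simp add: norm_mult norm_power)
  qed
  ultimately show ?thesis
    by (rule sums_unique2)
qed

subsection \<open>The Bergman space\<close>

lemma bergman_space_holomorphic: "f \<in> bergman_space \<Longrightarrow> f holomorphic_on unit_disc"
  by (simp add: bergman_space_def)

lemma bergman_space_continuous: "f \<in> bergman_space \<Longrightarrow> continuous_on unit_disc f"
  by (simp add: bergman_space_holomorphic holomorphic_on_imp_continuous_on)

lemma bergman_space_square_integrable:
  "f \<in> bergman_space \<Longrightarrow> set_integrable lborel unit_disc (\<lambda>z. (cmod (f z))\<^sup>2)"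
  by (simp add: bergman_space_def)

lemma set_integrable_bound_continuous:
  fixes F :: "complex \<Rightarrow> 'a::{banach, second_countable_topology}"
  assumes "continuous_on unit_disc F" "set_integrable lborel unit_disc B"
    and "\<And>z. z \<in> unit_disc \<Longrightarrow> norm (F z) \<le> (B z :: real)"
  shows "set_integrable lborel unit_disc F"
  unfolding set_integrable_def
proof (rule Bochner_Integration.integrable_bound)
  show "integrable lborel (\<lambda>z. indicator unit_disc z *\<^sub>R B z)"
    using assms(2) by (simp add: set_integrable_def)
  show "(\<lambda>z. indicator unit_disc z *\<^sub>R F z) \<in> borel_measurable lborel"
    using borel_measurable_continuous_on_indicator[OF _ assms(1)] by simp
  show "AE z in lborel. norm (indicator unit_disc z *\<^sub>R F z) \<le> norm (indicator unit_disc z *\<^sub>R B z)"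
    using assms(3) by (intro AE_I2) (force simp: indicator_def)
qed

lemma bergman_space_product_integrable:
  assumes "f \<in> bergman_space" "g \<in> bergman_space"
  shows "set_integrable lborel unit_disc (\<lambda>z. f z * cnj (g z))"
proof (rule set_integrable_bound_continuous)
  show "continuous_on unit_disc (\<lambda>z. f z * cnj (g z))"
    using assms by (intro continuous_intros bergman_space_continuous)
  show "set_integrable lborel unit_disc (\<lambda>z. (cmod (f z))\<^sup>2 + (cmod (g z))\<^sup>2)"
    using assms by (intro set_integral_add bergman_space_square_integrable)
  fix z
  have "2 * (cmod (f z) * cmod (g z)) \<le> (cmod (f z))\<^sup>2 + (cmod (g z))\<^sup>2"
    using sum_squares_bound[of "cmod (f z)" "cmod (g z)"] by (simp add: mult.assoc)
  moreover have "0 \<le> cmod (f z) * cmod (g z)" by simp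
  ultimately show "norm (f z * cnj (g z)) \<le> (cmod (f z))\<^sup>2 + (cmod (g z))\<^sup>2"
    unfolding norm_mult complex_mod_cnj by linarith
qed

lemma bergman_space_bounded:
  assumes "f holomorphic_on unit_disc" "\<And>z. z \<in> unit_disc \<Longrightarrow> cmod (f z) \<le> B"
  shows "f \<in> bergman_space"
proof -
  have "set_integrable lborel unit_disc (\<lambda>z. (cmod (f z))\<^sup>2)"
  proof (rule set_integrable_bounded_continuous)
    show "continuous_on unit_disc (\<lambda>z. (cmod (f z))\<^sup>2)"
      using assms(1) by (intro continuous_intros holomorphic_on_imp_continuous_on)
    show "norm ((cmod (f z))\<^sup>2) \<le> B\<^sup>2" if "z \<in> unit_disc" for z
      using assms(2)[OF that] by (auto intro: power_mono)
  qed
  with assms(1) show ?thesis by (simp add: bergman_space_def)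
qed

lemma bergman_space_zero [simp]: "(\<lambda>z. 0) \<in> bergman_space"
  by (rule bergman_space_bounded[where B = 0]) auto

lemma bergman_space_cmult:
  assumes "f \<in> bergman_space"
  shows "(\<lambda>z. c * f z) \<in> bergman_space"
  using assms by (auto simp: bergman_space_def norm_mult power_mult_distrib intro!: holomorphic_intros)

lemma bergman_space_add:
  assumes "f \<in> bergman_space" "g \<in> bergman_space"
  shows "(\<lambda>z. f z + g z) \<in> bergman_space"
proof -
  have "set_integrable lborel unit_disc (\<lambda>z. (cmod (f z + g z))\<^sup>2)"
  proof (rule set_integrable_bound_continuous)
    show "continuous_on unit_disc (\<lambda>z. (cmod (f z + g z))\<^sup>2)"
      using assms by (intro continuous_intros bergman_space_continuous)
    show "set_integrable lborel unit_disc (\<lambda>z. 2 * (cmod (f z))\<^sup>2 + 2 * (cmod (g z))\<^sup>2)"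
      using assms by (intro set_integral_add set_integrable_mult_right bergman_space_square_integrable)
    fix z
    have "(cmod (f z + g z))\<^sup>2 \<le> (cmod (f z) + cmod (g z))\<^sup>2"
      by (intro power_mono norm_triangle_ineq) auto
    also have "\<dots> \<le> 2 * (cmod (f z))\<^sup>2 + 2 * (cmod (g z))\<^sup>2"
      using sum_squares_bound[of "cmod (f z)" "cmod (g z)"] by (simp add: power2_sum)
    finally show "norm ((cmod (f z + g z))\<^sup>2) \<le> 2 * (cmod (f z))\<^sup>2 + 2 * (cmod (g z))\<^sup>2"
      by simp
  qed
  with assms show ?thesis by (auto simp: bergman_space_def intro!: holomorphic_intros)
qed

lemma bergman_space_diff:
  assumes "f \<in> bergman_space" "g \<in> bergman_space"
  shows "(\<lambda>z. f z - g z) \<in> bergman_space"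
  using bergman_space_add[OF assms(1) bergman_space_cmult[OF assms(2), of "-1"]] by simp

lemma bergman_space_sum:
  assumes "\<And>j. j \<in> J \<Longrightarrow> e j \<in> bergman_space"
  shows "(\<lambda>z. \<Sum>j\<in>J. c j * e j z) \<in> bergman_space"
  using assms
  by (induction J rule: infinite_finite_induct) (simp_all add: bergman_space_add bergman_space_cmult)

section \<open>The inner product and the norm\<close>

lemma bergman_inner_cnj: "cnj (bergman_inner f g) = bergman_inner g f"
proof -
  have "cnj (LINT z:unit_disc|lborel. f z * cnj (g z)) = (LINT z:unit_disc|lborel. cnj (f z * cnj (g z)))"
    unfolding set_lebesgue_integral_def by (subst Bochner_Integration.integral_cnj[symmetric]) simp
  then show ?thesis
    by (simp add: bergman_inner_def mult.commute)
qed

lemma bergman_norm_nonneg: "bergman_norm f \<ge> 0"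
  by (simp add: bergman_norm_def set_lebesgue_integral_def)

lemma bergman_norm_square:
  "(bergman_norm f)\<^sup>2 = (1 / pi) * (LINT z:unit_disc|lborel. (cmod (f z))\<^sup>2)"
  by (simp add: bergman_norm_def set_lebesgue_integral_def)

lemma bergman_inner_self: "bergman_inner f f = complex_of_real ((bergman_norm f)\<^sup>2)"
proof -
  have "(LINT z:unit_disc|lborel. f z * cnj (f z)) = (LINT z:unit_disc|lborel. complex_of_real ((cmod (f z))\<^sup>2))"
    by (simp only: complex_norm_square)
  also have "\<dots> = complex_of_real (LINT z:unit_disc|lborel. (cmod (f z))\<^sup>2)"
    by (rule set_integral_complex_of_real)
  finally show ?thesis
    unfolding bergman_inner_def bergman_norm_square by simp
qed

lemma bergman_inner_zero_left [simp]: "bergman_inner (\<lambda>z. 0) g = 0"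
  and bergman_inner_zero_right [simp]: "bergman_inner g (\<lambda>z. 0) = 0"
  by (simp_all add: bergman_inner_def set_lebesgue_integral_def)

lemma bergman_inner_add_left:
  assumes "f \<in> bergman_space" "g \<in> bergman_space" "h \<in> bergman_space"
  shows "bergman_inner (\<lambda>z. f z + g z) h = bergman_inner f h + bergman_inner g h"
  using set_integral_add(2)[OF bergman_space_product_integrable bergman_space_product_integrable, of f h g h] assms
  by (simp add: bergman_inner_def distrib_right add_divide_distrib)

lemma bergman_inner_diff_left:
  assumes "f \<in> bergman_space" "g \<in> bergman_space" "h \<in> bergman_space"
  shows "bergman_inner (\<lambda>z. f z - g z) h = bergman_inner f h - bergman_inner g h"
  using set_integral_diff(2)[OF bergman_space_product_integrable bergman_space_product_integrable, of f h g h] assms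
  by (simp add: bergman_inner_def left_diff_distrib diff_divide_distrib)

lemma bergman_inner_cmult_left: "bergman_inner (\<lambda>z. c * f z) h = c * bergman_inner f h"
  by (simp add: bergman_inner_def mult.assoc)

lemma bergman_inner_sum_left:
  assumes "\<And>j. j \<in> J \<Longrightarrow> e j \<in> bergman_space" "h \<in> bergman_space"
  shows "bergman_inner (\<lambda>z. \<Sum>j\<in>J. c j * e j z) h = (\<Sum>j\<in>J. c j * bergman_inner (e j) h)"
  using assms(1)
proof (induction J rule: infinite_finite_induct)
  case (insert x F)
  then have "bergman_inner (\<lambda>z. c x * e x z + (\<Sum>j\<in>F. c j * e j z)) h
     = bergman_inner (\<lambda>z. c x * e x z) h + bergman_inner (\<lambda>z. \<Sum>j\<in>F. c j * e j z) h"
    by (intro bergman_inner_add_left bergman_space_cmult bergman_space_sum assms(2)) auto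
  with insert show ?case by (simp add: bergman_inner_cmult_left)
qed simp_all

lemma bergman_inner_residual_left:
  assumes "f \<in> bergman_space" "\<And>j. j \<in> J \<Longrightarrow> e j \<in> bergman_space" "h \<in> bergman_space"
  shows "bergman_inner (\<lambda>z. f z - (\<Sum>j\<in>J. c j * e j z)) h
    = bergman_inner f h - (\<Sum>j\<in>J. c j * bergman_inner (e j) h)"
  using assms by (simp add: bergman_inner_diff_left bergman_inner_sum_left bergman_space_sum)

lemma bergman_inner_residual_right:
  assumes "f \<in> bergman_space" "\<And>j. j \<in> J \<Longrightarrow> e j \<in> bergman_space" "h \<in> bergman_space"
  shows "bergman_inner h (\<lambda>z. f z - (\<Sum>j\<in>J. c j * e j z))
    = bergman_inner h f - (\<Sum>j\<in>J. cnj (c j) * bergman_inner h (e j))"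
  using arg_cong[OF bergman_inner_residual_left[OF assms], where f = cnj]
  by (simp add: bergman_inner_cnj)

text \<open>When a residual has norm zero, \<^const>\<open>bergman_normalize\<close> divides by zero and returns the zero function.
  Allowing zero vectors makes linear independence of the generalized kernels unnecessary.\<close>

definition orthonormal_or_zero :: "(nat \<Rightarrow> complex \<Rightarrow> complex) \<Rightarrow> nat set \<Rightarrow> bool" where
  "orthonormal_or_zero e J \<longleftrightarrow> (\<forall>j\<in>J. e j \<in> bergman_space \<and>
     (e j = (\<lambda>z. 0) \<or> bergman_inner (e j) (e j) = 1) \<and>
     (\<forall>i\<in>J. i \<noteq> j \<longrightarrow> bergman_inner (e i) (e j) = 0))"

lemma orthonormal_or_zero_subset:
  "orthonormal_or_zero e J \<Longrightarrow> I \<subseteq> J \<Longrightarrow> orthonormal_or_zero e I"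
  unfolding orthonormal_or_zero_def by blast

text \<open>Orthogonality leaves the term \<open>i = j\<close>. Its second factor is
  \<open>1\<close>, unless \<open>e j\<close> is the zero function, and then both sides
  vanish.\<close>

lemma orthonormal_or_zero_sum_inner:
  assumes "orthonormal_or_zero e J" "finite J" "j \<in> J"
  shows "(\<Sum>i\<in>J. bergman_inner f (e i) * bergman_inner (e i) (e j)) = bergman_inner f (e j)"
proof -
  have "(\<Sum>i\<in>J. bergman_inner f (e i) * bergman_inner (e i) (e j))
      = (\<Sum>i\<in>J. if i = j then bergman_inner f (e j) else 0)"
    using assms by (intro sum.cong) (auto simp: orthonormal_or_zero_def)
  with assms show ?thesis by simp
qed

lemma residual_orthogonal:
  assumes "orthonormal_or_zero e J" "finite J" "f \<in> bergman_space" "j \<in> J"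
  shows "bergman_inner (\<lambda>z. f z - (\<Sum>i\<in>J. bergman_inner f (e i) * e i z)) (e j) = 0"
proof -
  have "\<And>i. i \<in> J \<Longrightarrow> e i \<in> bergman_space"
    using assms(1) by (simp add: orthonormal_or_zero_def)
  then show ?thesis
    using assms by (simp add: bergman_inner_residual_left orthonormal_or_zero_sum_inner)
qed

text \<open>The residual is orthogonal to every \<open>e j\<close>, so its inner product with itself
  equals that with \<open>f\<close>. Bessel's inequality follows because the left side is
  nonnegative.\<close>

lemma residual_norm:
  assumes on: "orthonormal_or_zero e J" and J: "finite J" and f: "f \<in> bergman_space"
  shows "(bergman_norm (\<lambda>z. f z - (\<Sum>j\<in>J. bergman_inner f (e j) * e j z)))\<^sup>2
    = (bergman_norm f)\<^sup>2 - (\<Sum>j\<in>J. (cmod (bergman_inner f (e j)))\<^sup>2)"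
proof -
  let ?r = "\<lambda>z. f z - (\<Sum>j\<in>J. bergman_inner f (e j) * e j z)"
  have e: "\<And>j. j \<in> J \<Longrightarrow> e j \<in> bergman_space"
    using on by (simp add: orthonormal_or_zero_def)
  then have r: "?r \<in> bergman_space"
    by (intro bergman_space_diff bergman_space_sum f)
  have "bergman_inner ?r ?r = bergman_inner ?r f"
    using residual_orthogonal[OF on J f] by (subst bergman_inner_residual_right[OF f e r]) simp_all
  also have "\<dots> = bergman_inner f f - (\<Sum>j\<in>J. bergman_inner f (e j) * cnj (bergman_inner f (e j)))"
    using f e by (simp add: bergman_inner_residual_left bergman_inner_cnj)
  also have "\<dots> = complex_of_real ((bergman_norm f)\<^sup>2 - (\<Sum>j\<in>J. (cmod (bergman_inner f (e j)))\<^sup>2))"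
    by (simp only: bergman_inner_self complex_norm_square of_real_diff of_real_sum)
  finally show ?thesis
    unfolding bergman_inner_self of_real_eq_iff .
qed

text \<open>Pythagoras gives equality for orthonormal families; a zero member drops its coefficient
  from the left side, hence only an inequality.\<close>

lemma combination_norm_le:
  assumes on: "orthonormal_or_zero e J" and J: "finite J"
  shows "(bergman_norm (\<lambda>z. \<Sum>j\<in>J. c j * e j z))\<^sup>2 \<le> (\<Sum>j\<in>J. (cmod (c j))\<^sup>2)"
proof -
  let ?s = "\<lambda>z. \<Sum>j\<in>J. c j * e j z"
  have e: "\<And>j. j \<in> J \<Longrightarrow> e j \<in> bergman_space"
    using on by (simp add: orthonormal_or_zero_def)
  have s: "?s \<in> bergman_space" by (rule bergman_space_sum[OF e])
  have se: "bergman_inner ?s (e j) = c j * bergman_inner (e j) (e j)" if j: "j \<in> J" for j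
  proof -
    have "(\<Sum>i\<in>J. c i * bergman_inner (e i) (e j)) = (\<Sum>i\<in>J. if i = j then c j * bergman_inner (e j) (e j) else 0)"
      using on j by (intro sum.cong) (auto simp: orthonormal_or_zero_def)
    with j J e show ?thesis by (simp add: bergman_inner_sum_left)
  qed
  have "bergman_inner ?s ?s = (\<Sum>j\<in>J. c j * cnj (bergman_inner ?s (e j)))"
    using bergman_inner_sum_left[OF e s] by (simp add: bergman_inner_cnj)
  also have "\<dots> = (\<Sum>j\<in>J. complex_of_real ((cmod (c j))\<^sup>2 * (bergman_norm (e j))\<^sup>2))"
    by (intro sum.cong refl)
      (simp only: se bergman_inner_self of_real_mult complex_norm_square complex_cnj_mult
        complex_cnj_complex_of_real mult.assoc)
  finally have "(bergman_norm ?s)\<^sup>2 = (\<Sum>j\<in>J. (cmod (c j))\<^sup>2 * (bergman_norm (e j))\<^sup>2)"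
    unfolding bergman_inner_self of_real_sum[symmetric] of_real_eq_iff .
  also have "\<dots> \<le> (\<Sum>j\<in>J. (cmod (c j))\<^sup>2)"
  proof (intro sum_mono mult_left_le)
    fix j assume "j \<in> J"
    then have "e j = (\<lambda>z. 0) \<or> complex_of_real ((bergman_norm (e j))\<^sup>2) = 1"
      using on by (simp add: orthonormal_or_zero_def bergman_inner_self)
    then show "(bergman_norm (e j))\<^sup>2 \<le> 1"
      by (auto simp: bergman_norm_def set_lebesgue_integral_def simp flip: of_real_power)
  qed simp
  finally show ?thesis .
qed

text \<open>Norm zero forces \<open>g\<close> to vanish almost everywhere on the disc. This covers a
  Gram-Schmidt step whose residual has norm zero.\<close>

lemma bergman_norm_eq_0_imp_inner_eq_0:
  assumes f: "f \<in> bergman_space" and g: "g \<in> bergman_space" and "bergman_norm g = 0"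
  shows "bergman_inner f g = 0"
proof -
  have "(LINT z|lborel. indicator unit_disc z *\<^sub>R (cmod (g z))\<^sup>2) = 0"
    using assms(3) by (simp add: bergman_norm_def set_lebesgue_integral_def)
  then have "AE z in lborel. indicator unit_disc z *\<^sub>R (cmod (g z))\<^sup>2 = 0"
    using bergman_space_square_integrable[OF g]
    by (subst (asm) integral_nonneg_eq_0_iff_AE) (auto simp: set_integrable_def)
  then have "AE z in lborel. indicator unit_disc z *\<^sub>R (f z * cnj (g z)) = 0"
    by eventually_elim (auto simp: indicator_def split: if_splits)
  then show ?thesis
    by (simp add: bergman_inner_def set_lebesgue_integral_def integral_eq_zero_AE)
qed

text \<open>The disc is exhausted by balls of radius \<open>r n\<close> tending to \<open>1\<close>.
  In \<open>integral_holomorphic_kernel\<close> the integrals converge to the integral over the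
  disc, and the values of \<open>g\<close> converge by continuity at \<open>b\<close>.\<close>

lemma bergman_inner_kernel:
  assumes g: "g \<in> bergman_space" and k: "bergman_kernel b \<in> bergman_space" and b: "cmod b < 1"
  shows "bergman_inner g (bergman_kernel b) = g b"
proof -
  \<comment> \<open>The summand \<open>2\<close> keeps \<open>r 0\<close> positive.\<close>
  define r where "r n = 1 - 1 / (real n + 2)" for n
  have r: "0 < r n" "r n < 1" for n by (simp_all add: r_def field_simps)
  have r_lim: "r \<longlonglongrightarrow> 1" unfolding r_def by real_asymp
  have r_mono: "r m \<le> r n" if "m \<le> n" for m n
    using that by (simp add: r_def frac_le)
  have union: "(\<Union>n. ball (0::complex) (r n)) = unit_disc"
  proof (intro equalityI subsetI)
    fix z :: complex assume "z \<in> unit_disc"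
    with r_lim have "eventually (\<lambda>n. cmod z < r n) sequentially"
      by (intro order_tendstoD) auto
    then show "z \<in> (\<Union>n. ball 0 (r n))" by (auto simp: eventually_sequentially)
  next
    fix z assume "z \<in> (\<Union>n. ball (0::complex) (r n))"
    then obtain n where "cmod z < r n" by auto
    with r(2)[of n] show "z \<in> unit_disc" by simp
  qed
  let ?F = "\<lambda>z. g z * cnj (bergman_kernel b z)"
  have "(\<lambda>n. LINT z:ball 0 (r n)|lborel. ?F z) \<longlonglongrightarrow> (LINT z:(\<Union>n. ball 0 (r n))|lborel. ?F z)"
    using bergman_space_product_integrable[OF g k]
    by (intro set_integral_cont_up) (auto simp: union incseq_def dest: r_mono)
  then have lim1: "(\<lambda>n. LINT z:ball 0 (r n)|lborel. ?F z) \<longlonglongrightarrow> (LINT z:unit_disc|lborel. ?F z)"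
    by (simp only: union)
  have "isCont g b"
    using bergman_space_continuous[OF g] b by (simp add: continuous_on_eq_continuous_at)
  moreover have "(\<lambda>n. complex_of_real ((r n)\<^sup>2) * b) \<longlonglongrightarrow> complex_of_real (1\<^sup>2) * b"
    by (intro tendsto_intros r_lim)
  then have "(\<lambda>n. complex_of_real ((r n)\<^sup>2) * b) \<longlonglongrightarrow> b" by simp
  ultimately have "(\<lambda>n. g (complex_of_real ((r n)\<^sup>2) * b)) \<longlonglongrightarrow> g b"
    by (rule isCont_tendsto_compose)
  then have "(\<lambda>n. complex_of_real (pi * (r n)\<^sup>2) * g (complex_of_real ((r n)\<^sup>2) * b)) \<longlonglongrightarrow> complex_of_real (pi * 1\<^sup>2) * g b"
    by (intro tendsto_intros r_lim)
  moreover have "(\<lambda>n. complex_of_real (pi * (r n)\<^sup>2) * g (complex_of_real ((r n)\<^sup>2) * b))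
      \<longlonglongrightarrow> (LINT z:unit_disc|lborel. ?F z)"
    using lim1 unfolding integral_holomorphic_kernel[OF bergman_space_holomorphic[OF g] r b] .
  ultimately have "(LINT z:unit_disc|lborel. ?F z) = complex_of_real (pi * 1\<^sup>2) * g b"
    by (rule LIMSEQ_unique[rotated])
  then show ?thesis by (simp add: bergman_inner_def)
qed

text \<open>Induction over initial segments: each residual is orthogonal to the earlier members, and
  normalizing gives a unit vector or zero. Any two indices lie in a common segment, which settles
  the infinite family.\<close>

lemma gram_schmidt_orthonormal_or_zero:
  assumes K: "\<And>j. j \<ge> 1 \<Longrightarrow> K j \<in> bergman_space"
  shows "orthonormal_or_zero (gram_schmidt K) {1..}"
proof -
  let ?e = "gram_schmidt K"
  have "orthonormal_or_zero ?e {1..<n}" for n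
  proof (induction n)
    case 0
    then show ?case by (simp add: orthonormal_or_zero_def)
  next
    case (Suc n)
    show ?case
    proof (cases "n = 0")
      case True
      then show ?thesis by (simp add: orthonormal_or_zero_def)
    next
      case False
      let ?r = "\<lambda>z. K n z - (\<Sum>j = 1..<n. bergman_inner (K n) (?e j) * ?e j z)"
      define t where "t = complex_of_real (bergman_norm ?r)"
      have Kn: "K n \<in> bergman_space" using K False by simp
      have e: "\<And>j. j \<in> {1..<n} \<Longrightarrow> ?e j \<in> bergman_space"
        using Suc by (simp add: orthonormal_or_zero_def)
      have r: "?r \<in> bergman_space"
        by (intro bergman_space_diff bergman_space_sum Kn e)
      have en: "?e n = (\<lambda>z. (1 / t) * ?r z)"
        by (subst gram_schmidt.simps) (simp add: bergman_normalize_def t_def)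
      have en_space: "?e n \<in> bergman_space"
        unfolding en by (rule bergman_space_cmult[OF r])
      have orth: "bergman_inner (?e n) (?e j) = 0" if "j \<in> {1..<n}" for j
        using residual_orthogonal[OF Suc _ Kn that] unfolding en bergman_inner_cmult_left by simp
      then have orth': "bergman_inner (?e j) (?e n) = 0" if "j \<in> {1..<n}" for j
        using that bergman_inner_cnj[of "?e n" "?e j"] by simp
      have unit: "?e n = (\<lambda>z. 0) \<or> bergman_inner (?e n) (?e n) = 1"
      proof (cases "t = 0")
        case True
        then show ?thesis by (simp add: en)
      next
        case False
        \<comment> \<open>Homogeneity is applied in the first argument only; the two arguments are
          then exchanged by conjugation, which fixes the real number \<open>t\<close>.\<close>
        have "bergman_inner (?e n) ?r = (1 / t) * t\<^sup>2"
          unfolding en bergman_inner_cmult_left bergman_inner_self by (simp add: t_def)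
        also have "\<dots> = t" using False by (simp add: power2_eq_square)
        finally have "bergman_inner ?r (?e n) = t"
          using bergman_inner_cnj[of "?e n" ?r] by (simp add: t_def)
        moreover have "bergman_inner (?e n) (?e n) = (1 / t) * bergman_inner ?r (?e n)"
          using bergman_inner_cmult_left[of "1 / t" ?r "?e n"] by (simp only: en[symmetric])
        ultimately show ?thesis using False by simp
      qed
      have "{1..<Suc n} = insert n {1..<n}" using False by auto
      with Suc en_space orth orth' unit show ?thesis
        unfolding orthonormal_or_zero_def by auto
    qed
  qed
  note finite_part = this
  show ?thesis
    unfolding orthonormal_or_zero_def
  proof (intro ballI conjI impI)
    fix i j :: nat assume "i \<in> {1..}" "j \<in> {1..}"
    then have "i \<in> {1..<Suc (max i j)}" "j \<in> {1..<Suc (max i j)}" by auto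
    with finite_part[of "Suc (max i j)"]
    show "?e j \<in> bergman_space" "?e j = (\<lambda>z. 0) \<or> bergman_inner (?e j) (?e j) = 1"
      "i \<noteq> j \<Longrightarrow> bergman_inner (?e i) (?e j) = 0"
      unfolding orthonormal_or_zero_def by blast+
  qed
qed

lemma gram_schmidt_residual_bound:
  assumes f: "f \<in> bergman_space" and K: "\<And>j. j \<ge> 1 \<Longrightarrow> K j \<in> bergman_space"
    and n: "n \<ge> 1" and Kn: "K n = bergman_kernel b" and b: "cmod b < 1"
  shows "cmod (f b - (\<Sum>j = 1..<n. bergman_inner f (gram_schmidt K j) * gram_schmidt K j b))
    \<le> cmod (bergman_inner f (gram_schmidt K n)) * bergman_norm (bergman_kernel b)"
proof -
  let ?e = "gram_schmidt K" and ?k = "bergman_kernel b"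
  let ?r = "\<lambda>z. ?k z - (\<Sum>j = 1..<n. bergman_inner ?k (?e j) * ?e j z)"
  have on: "orthonormal_or_zero ?e {1..<n}"
    by (rule orthonormal_or_zero_subset[OF gram_schmidt_orthonormal_or_zero[OF K]]) auto
  then have e: "\<And>j. j \<in> {1..<n} \<Longrightarrow> ?e j \<in> bergman_space"
    by (simp add: orthonormal_or_zero_def)
  have k: "?k \<in> bergman_space" using K[OF n] Kn by simp
  have r: "?r \<in> bergman_space"
    by (intro bergman_space_diff bergman_space_sum k e)
  have "bergman_inner f ?r
      = bergman_inner f ?k - (\<Sum>j = 1..<n. cnj (bergman_inner ?k (?e j)) * bergman_inner f (?e j))"
    using e by (intro bergman_inner_residual_right k f) auto
  \<comment> \<open>By the reproducing property \<open>cnj (bergman_inner ?k (?e j))\<close> is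
    \<open>?e j b\<close>: the projection moves from the kernel to \<open>f\<close>.\<close>
  also have "\<dots> = f b - (\<Sum>j = 1..<n. bergman_inner f (?e j) * ?e j b)"
    unfolding bergman_inner_kernel[OF f k b] bergman_inner_cnj
    by (intro arg_cong2[of _ _ _ _ minus] sum.cong refl)
      (simp only: bergman_inner_kernel[OF e k b] mult.commute)
  finally have "bergman_inner f ?r = f b - (\<Sum>j = 1..<n. bergman_inner f (?e j) * ?e j b)" .
  moreover have "cmod (bergman_inner f ?r) \<le> cmod (bergman_inner f (?e n)) * bergman_norm ?k"
  proof (cases "bergman_norm ?r = 0")
    \<comment> \<open>A residual of norm zero is orthogonal to \<open>f\<close>, so the bound holds
      although \<open>?e n\<close> is then the zero function.\<close>
    case True
    then show ?thesis
      using bergman_norm_eq_0_imp_inner_eq_0[OF f r] by (simp add: bergman_norm_nonneg)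
  next
    case False
    define t where "t = bergman_norm ?r"
    have t: "t > 0" using False bergman_norm_nonneg[of ?r] by (simp add: t_def)
    have en: "?e n = (\<lambda>z. (1 / complex_of_real t) * ?r z)"
      by (subst gram_schmidt.simps) (simp add: bergman_normalize_def t_def Kn)
    have "cnj (bergman_inner f (?e n)) = (1 / complex_of_real t) * cnj (bergman_inner f ?r)"
      unfolding bergman_inner_cnj en bergman_inner_cmult_left ..
    from arg_cong[OF this, where f = cmod] have "cmod (bergman_inner f (?e n)) = 1 / t * cmod (bergman_inner f ?r)"
      using t by (simp only: norm_mult norm_divide complex_mod_cnj norm_of_real norm_one abs_of_pos)
    then have "cmod (bergman_inner f ?r) = cmod (bergman_inner f (?e n)) * t"
      using t by simp
    moreover have "t \<le> bergman_norm ?k"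
    proof (rule power2_le_imp_le[OF _ bergman_norm_nonneg])
      show "t\<^sup>2 \<le> (bergman_norm ?k)\<^sup>2"
        unfolding t_def residual_norm[OF on finite_atLeastLessThan k] by (simp add: sum_nonneg)
    qed
    ultimately show ?thesis by (simp add: mult_left_mono)
  qed
  ultimately show ?thesis by simp
qed

subsection \<open>Generalized kernels\<close>

lemma dbar_eq_of_has_derivative:
  "(g has_derivative D) (at w) \<Longrightarrow> dbar g w = (D 1 + \<i> * D \<i>) / 2"
  by (simp add: dbar_def frechet_derivative_at[symmetric])

text \<open>The real derivative of \<open>G (cnj v)\<close> is \<open>A * cnj h\<close>, and
  \<open>(A + \<i> * (A * cnj \<i>)) / 2 = A\<close>. Agreement on an open set suffices, as needed
  for iterated derivatives whose closed form is known only in the disc.\<close>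

lemma dbar_cnj_comp:
  assumes "(G has_field_derivative A) (at (cnj w))" "open S" "w \<in> S"
    and "\<And>v. v \<in> S \<Longrightarrow> g v = G (cnj v)"
  shows "dbar g w = A"
proof -
  have "((\<lambda>v. G (cnj v)) has_derivative (\<lambda>h. A * cnj h)) (at w)"
    by (rule has_derivative_compose[OF has_derivative_cnj[OF has_derivative_ident]])
      (use assms(1) in \<open>simp add: has_field_derivative_def\<close>)
  then have D: "(g has_derivative (\<lambda>h. A * cnj h)) (at w)"
    by (rule has_derivative_transform_within_open[OF _ assms(2,3)]) (simp add: assms(4))
  show ?thesis
    unfolding dbar_eq_of_has_derivative[OF D] by (simp add: complex_eq_iff)
qed

text \<open>For \<open>w\<close> in the disc this keeps the denominators of the kernels away from
  zero, uniformly in \<open>z\<close>.\<close>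

lemma one_minus_cnj_mult_ge:
  assumes "cmod z < 1"
  shows "1 - cmod w \<le> cmod (1 - cnj w * z)"
proof -
  have "cmod w * cmod z \<le> cmod w * 1" using assms by (intro mult_left_mono) auto
  moreover have "1 - cmod (cnj w * z) \<le> cmod (1 - cnj w * z)"
    using norm_triangle_ineq2[of 1 "cnj w * z"] by simp
  ultimately show ?thesis by (simp add: norm_mult)
qed

text \<open>Each derivative in \<open>cnj w\<close> brings down the exponent and one factor
  \<open>z\<close>; the successive exponents build up the factorial. The induction keeps
  \<open>w\<close> arbitrary because differentiating needs the formula in a neighbourhood.\<close>

lemma dbar_power_bergman_kernel:
  assumes z: "cmod z < 1" and "cmod w < 1"
  shows "(dbar ^^ m) (\<lambda>w. bergman_kernel w z) w = fact (Suc m) * z ^ m / (1 - cnj w * z) ^ (m + 2)"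
  using assms(2)
proof (induction m arbitrary: w)
  case 0
  then show ?case by (simp add: bergman_kernel_def power2_eq_square)
next
  case (Suc m)
  define u where "u = cnj w"
  have nz: "1 - u * z \<noteq> 0"
    using one_minus_cnj_mult_ge[OF z, of w] Suc.prems by (auto simp: u_def)
  have "((\<lambda>u. inverse (1 - u * z)) has_field_derivative z * (inverse (1 - u * z))\<^sup>2) (at u)"
    using nz by (auto intro!: derivative_eq_intros simp: power2_eq_square)
  from DERIV_cmult[OF DERIV_power[OF this, of "m + 2"], of "fact (Suc m) * z ^ m"]
  have "((\<lambda>u. fact (Suc m) * z ^ m * inverse (1 - u * z) ^ (m + 2)) has_field_derivative
      fact (Suc m) * z ^ m * (of_nat (m + 2) * (z * (inverse (1 - u * z))\<^sup>2 * inverse (1 - u * z) ^ (m + 2 - Suc 0)))) (at u)" .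
  also have "fact (Suc m) * z ^ m * (of_nat (m + 2) * (z * (inverse v)\<^sup>2 * inverse v ^ (m + 2 - Suc 0)))
      = fact (Suc (Suc m)) * z ^ Suc m / v ^ (Suc m + 2)" for v
    by (simp add: divide_inverse power2_eq_square power_inverse algebra_simps)
  finally have "dbar ((dbar ^^ m) (\<lambda>w. bergman_kernel w z)) w
      = fact (Suc (Suc m)) * z ^ Suc m / (1 - u * z) ^ (Suc m + 2)"
    unfolding u_def
    by (rule dbar_cnj_comp[where S = unit_disc]) (use Suc in \<open>auto simp: divide_inverse power_inverse\<close>)
  then show ?case by (simp add: u_def)
qed

text \<open>On the disc the closed form is holomorphic and bounded, its denominator being bounded
  below.\<close>

lemma generalized_kernel_in_bergman_space:
  assumes "cmod (a j) < 1"
  shows "generalized_kernel a j \<in> bergman_space"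
proof (rule bergman_space_bounded)
  define m where "m = occurrence a j - 1"
  have eq: "generalized_kernel a j z = fact (Suc m) * z ^ m / (1 - cnj (a j) * z) ^ (m + 2)"
    if "z \<in> unit_disc" for z
    using dbar_power_bergman_kernel[of z "a j" m] that assms
    by (simp add: generalized_kernel_def m_def)
  have lower: "1 - cmod (a j) \<le> cmod (1 - cnj (a j) * z)" if "z \<in> unit_disc" for z
    using that by (intro one_minus_cnj_mult_ge) simp
  have "(\<lambda>z. fact (Suc m) * z ^ m / (1 - cnj (a j) * z) ^ (m + 2)) holomorphic_on unit_disc"
    using lower assms by (intro holomorphic_intros) force
  then show "generalized_kernel a j holomorphic_on unit_disc"
    by (rule holomorphic_transform) (simp only: eq)
  show "cmod (generalized_kernel a j z) \<le> fact (Suc m) / (1 - cmod (a j)) ^ (m + 2)"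
    if z: "z \<in> unit_disc" for z
  proof -
    have "cmod z ^ m \<le> 1" using z by (intro power_le_one) auto
    moreover have "(1 - cmod (a j)) ^ (m + 2) \<le> cmod (1 - cnj (a j) * z) ^ (m + 2)"
      using lower[OF z] assms by (intro power_mono) auto
    moreover have "0 < (1 - cmod (a j)) ^ (m + 2)" using assms by simp
    ultimately have "fact (Suc m) * cmod z ^ m / cmod (1 - cnj (a j) * z) ^ (m + 2)
        \<le> fact (Suc m) * 1 / (1 - cmod (a j)) ^ (m + 2)"
      by (intro frac_le mult_left_mono) auto
    then show ?thesis
      by (simp only: eq[OF z] norm_divide norm_mult norm_power norm_fact mult_1_right)
  qed
qed

section \<open>Replacing one entry of the tuple\<close>

lemma gram_schmidt_cong:
  assumes "\<And>j. 1 \<le> j \<Longrightarrow> j \<le> n \<Longrightarrow> K j = K' j" "1 \<le> n"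
  shows "gram_schmidt K n = gram_schmidt K' n"
  using assms
proof (induction n rule: less_induct)
  case (less n)
  have "(\<Sum>j = 1..<n. bergman_inner (K n) (gram_schmidt K j) * gram_schmidt K j z)
      = (\<Sum>j = 1..<n. bergman_inner (K' n) (gram_schmidt K' j) * gram_schmidt K' j z)" for z
    using less by (intro sum.cong) auto
  with less.prems show ?case
    by (subst (1 2) gram_schmidt.simps) simp
qed

lemma generalized_kernel_fun_upd:
  assumes "j < n"
  shows "generalized_kernel (a(n := b)) j = generalized_kernel a j"
proof -
  have "occurrence (a(n := b)) j = occurrence a j"
    unfolding occurrence_def using assms by (intro arg_cong[of _ _ card]) auto
  with assms show ?thesis
    by (simp add: generalized_kernel_def fun_eq_iff)
qed

text \<open>Ensures that the competitor \<open>b\<close> at index \<open>n\<close> is measured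
  against the same residual of \<open>f\<close> as the selected point \<open>a n\<close>.\<close>

lemma bergman_basis_fun_upd:
  "1 \<le> j \<Longrightarrow> j < n \<Longrightarrow> bergman_basis (a(n := b)) j = bergman_basis a j"
  unfolding bergman_basis_def by (intro gram_schmidt_cong generalized_kernel_fun_upd) auto

text \<open>A new point occurs once, so no derivative is taken. \<open>range a\<close> also contains
  \<open>a 0\<close>, which leaves the set of excluded points countable.\<close>

lemma generalized_kernel_fresh:
  assumes "b \<notin> range a" "1 \<le> n"
  shows "generalized_kernel (a(n := b)) n = bergman_kernel b"
proof -
  have "{i \<in> {1..n}. (a(n := b)) i = (a(n := b)) n} = {n}"
    using assms by auto
  then show ?thesis
    by (simp add: generalized_kernel_def occurrence_def fun_eq_iff)
qed

subsection \<open>Convergence of the residuals\<close>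

text \<open>Fatou's lemma for the squared moduli. Asking for the limit only almost everywhere allows
  the points of the sequence to be excluded.\<close>

lemma bergman_norm_le_pointwise_limit:
  assumes g: "\<And>n. g n \<in> bergman_space" and h: "h \<in> bergman_space"
    and lim: "AE z in lborel. z \<in> unit_disc \<longrightarrow> (\<lambda>n. g n z) \<longlonglongrightarrow> h z"
    and bound: "\<And>n. (bergman_norm (g n))\<^sup>2 \<le> B"
  shows "(bergman_norm h)\<^sup>2 \<le> B"
proof -
  let ?I = "\<lambda>f z. ennreal (indicator unit_disc z * (cmod (f z))\<^sup>2)"
  have norm: "(\<integral>\<^sup>+z. ?I f z \<partial>lborel) = ennreal (pi * (bergman_norm f)\<^sup>2)" if "f \<in> bergman_space" for f
    using bergman_space_square_integrable[OF that] unfolding bergman_norm_square set_lebesgue_integral_def set_integrable_def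
    by (subst nn_integral_eq_integral) auto
  have meas: "?I (g n) \<in> borel_measurable lborel" for n
    using bergman_space_square_integrable[OF g[of n]] unfolding set_integrable_def
    by (auto intro!: measurable_compose[OF borel_measurable_integrable measurable_ennreal])
  have "ennreal (pi * (bergman_norm h)\<^sup>2) = (\<integral>\<^sup>+z. ?I h z \<partial>lborel)"
    by (simp add: norm[OF h])
  also have "\<dots> = (\<integral>\<^sup>+z. liminf (\<lambda>n. ?I (g n) z) \<partial>lborel)"
  proof (rule nn_integral_cong_AE, use lim in eventually_elim)
    fix z assume z: "z \<in> unit_disc \<longrightarrow> (\<lambda>n. g n z) \<longlonglongrightarrow> h z"
    have "(\<lambda>n. ?I (g n) z) \<longlonglongrightarrow> ?I h z"
    proof (cases "z \<in> unit_disc")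
      case True
      with z have "(\<lambda>n. g n z) \<longlonglongrightarrow> h z" by simp
      then show ?thesis by (intro tendsto_ennrealI tendsto_intros)
    qed simp
    then show "?I h z = liminf (\<lambda>n. ?I (g n) z)"
      by (rule lim_imp_Liminf[OF trivial_limit_sequentially, symmetric])
  qed
  also have "\<dots> \<le> liminf (\<lambda>n. \<integral>\<^sup>+z. ?I (g n) z \<partial>lborel)"
    by (rule nn_integral_liminf[OF meas])
  also have "\<dots> \<le> ennreal (pi * B)"
    using bound by (intro Liminf_le eventually_sequentiallyI[of 0]) (auto simp: norm[OF g] ennreal_leI)
  \<comment> \<open>\<open>ennreal\<close> truncates negative numbers to \<open>0\<close>;
    \<open>B\<close> is nonnegative because it bounds a square.\<close>
  finally have "pi * (bergman_norm h)\<^sup>2 \<le> pi * B"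
    using order_trans[OF zero_le_power2 bound] by (subst (asm) ennreal_le_iff) auto
  then show ?thesis by simp
qed

text \<open>Bessel's inequality for one vector; it bounds the set whose supremum defines a maximal
  selection.\<close>

lemma bergman_inner_le_norm:
  assumes f: "f \<in> bergman_space" and on: "orthonormal_or_zero e {n}"
  shows "(cmod (bergman_inner f (e n)))\<^sup>2 \<le> (bergman_norm f)\<^sup>2"
proof -
  have "0 \<le> (bergman_norm (\<lambda>z. f z - (\<Sum>j\<in>{n}. bergman_inner f (e j) * e j z)))\<^sup>2"
    by (rule zero_le_power2)
  also have "\<dots> = (bergman_norm f)\<^sup>2 - (\<Sum>j\<in>{n}. (cmod (bergman_inner f (e j)))\<^sup>2)"
    by (rule residual_norm[OF on _ f]) simp
  finally show ?thesis by simp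
qed

lemma selection_residual_bound:
  assumes f: "f \<in> bergman_space" and a: "\<And>n. n \<ge> 1 \<Longrightarrow> a n \<in> unit_disc"
    and sel: "consecutive_maximal_selections f a"
    and b: "b \<in> unit_disc" "b \<notin> range a" and n: "n \<ge> 1"
  shows "cmod (f b - (\<Sum>k = 1..<n. bergman_inner f (bergman_basis a k) * bergman_basis a k b))
    \<le> cmod (bergman_inner f (bergman_basis a n)) * bergman_norm (bergman_kernel b)"
proof -
  have K: "generalized_kernel (a(n := c)) j \<in> bergman_space" if "c \<in> unit_disc" "j \<ge> 1" for c j
    using a that by (intro generalized_kernel_in_bergman_space) auto
  have on: "orthonormal_or_zero (bergman_basis (a(n := c))) {1..}" if "c \<in> unit_disc" for c
    unfolding bergman_basis_def by (rule gram_schmidt_orthonormal_or_zero[OF K[OF that]])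
  \<comment> \<open>A real \<open>SUP\<close> dominates the members of its set only once the set is
    known to be bounded above.\<close>
  have bdd: "bdd_above ((\<lambda>c. (cmod (bergman_inner f (bergman_basis (a(n := c)) n)))\<^sup>2) ` unit_disc)"
  proof (rule bdd_aboveI2)
    fix c :: complex assume "c \<in> unit_disc"
    then have "orthonormal_or_zero (bergman_basis (a(n := c))) {n}"
      using n by (intro orthonormal_or_zero_subset[OF on]) auto
    then show "(cmod (bergman_inner f (bergman_basis (a(n := c)) n)))\<^sup>2 \<le> (bergman_norm f)\<^sup>2"
      by (rule bergman_inner_le_norm[OF f])
  qed
  have "(cmod (bergman_inner f (bergman_basis (a(n := b)) n)))\<^sup>2
      \<le> (SUP c\<in>unit_disc. (cmod (bergman_inner f (bergman_basis (a(n := c)) n)))\<^sup>2)"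
    by (rule cSUP_upper[OF b(1) bdd])
  also have "\<dots> = (cmod (bergman_inner f (bergman_basis a n)))\<^sup>2"
    using sel n by (simp add: consecutive_maximal_selections_def)
  finally have max: "cmod (bergman_inner f (bergman_basis (a(n := b)) n)) \<le> cmod (bergman_inner f (bergman_basis a n))"
    by (rule power2_le_imp_le) simp
  have "cmod (f b - (\<Sum>k = 1..<n. bergman_inner f (bergman_basis (a(n := b)) k) * bergman_basis (a(n := b)) k b))
    \<le> cmod (bergman_inner f (bergman_basis (a(n := b)) n)) * bergman_norm (bergman_kernel b)"
    unfolding bergman_basis_def using b n
    by (intro gram_schmidt_residual_bound f K generalized_kernel_fresh) auto
  also have "(\<Sum>k = 1..<n. bergman_inner f (bergman_basis (a(n := b)) k) * bergman_basis (a(n := b)) k b)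
     = (\<Sum>k = 1..<n. bergman_inner f (bergman_basis a k) * bergman_basis a k b)"
    by (intro sum.cong) (simp_all add: bergman_basis_fun_upd)
  finally show ?thesis
    using mult_right_mono[OF max bergman_norm_nonneg[of "bergman_kernel b"]] by linarith
qed

theorem theorem4p3:
  fixes f :: "complex \<Rightarrow> complex" and a :: "nat \<Rightarrow> complex"
  assumes "f \<in> bergman_space"
    and "\<And>n. n \<ge> 1 \<Longrightarrow> a n \<in> unit_disc"
    and "consecutive_maximal_selections f a"
  shows "(\<lambda>N. bergman_norm (\<lambda>z. f z -
            (\<Sum>k = 1..N. bergman_inner f (bergman_basis a k) * bergman_basis a k z)))
          \<longlonglongrightarrow> 0"
proof -
  define e where "e = bergman_basis a"
  define c where "c k = bergman_inner f (e k)" for k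
  define S where "S N = (\<Sum>k = 1..N. (cmod (c k))\<^sup>2)" for N
  define r where "r N z = f z - (\<Sum>k = 1..N. c k * e k z)" for N z
  have on: "orthonormal_or_zero e {1..}"
    unfolding e_def bergman_basis_def using assms(2)
    by (intro gram_schmidt_orthonormal_or_zero generalized_kernel_in_bergman_space) auto
  then have on_finite: "orthonormal_or_zero e {m..n}" if "m \<ge> 1" for m n
    using that by (intro orthonormal_or_zero_subset[OF on]) auto
  have e: "e j \<in> bergman_space" if "j \<ge> 1" for j
    using on that by (simp add: orthonormal_or_zero_def)
  have r: "r N \<in> bergman_space" for N
    unfolding r_def by (intro bergman_space_diff bergman_space_sum assms(1) e) auto
  have bessel: "S N \<le> (bergman_norm f)\<^sup>2" for N
  proof -
    have "0 \<le> (bergman_norm (r N))\<^sup>2" by simp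
    also have "\<dots> = (bergman_norm f)\<^sup>2 - S N"
      unfolding r_def c_def S_def by (rule residual_norm[OF on_finite _ assms(1)]) auto
    finally show ?thesis by simp
  qed
  have S_Suc: "S (Suc N) = S N + (cmod (c (Suc N)))\<^sup>2" for N
    by (simp add: S_def)
  have "incseq S" by (rule incseq_SucI) (simp add: S_Suc)
  then obtain L where L: "S \<longlonglongrightarrow> L" "\<And>N. S N \<le> L"
    using incseq_convergent[of S "(bergman_norm f)\<^sup>2"] bessel by auto
  have "(\<lambda>N. S (Suc N) - S N) \<longlonglongrightarrow> L - L"
    by (intro tendsto_diff L LIMSEQ_Suc)
  then have "(\<lambda>N. sqrt ((cmod (c (Suc N)))\<^sup>2)) \<longlonglongrightarrow> sqrt 0"
    by (intro tendsto_real_sqrt) (simp add: S_Suc)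
  then have c_lim: "(\<lambda>N. cmod (c (Suc N))) \<longlonglongrightarrow> 0" by simp
  have pointwise: "(\<lambda>N. r N b) \<longlonglongrightarrow> 0" if b: "b \<in> unit_disc" "b \<notin> range a" for b
  proof (rule tendsto_norm_zero_cancel, rule tendsto_sandwich[OF _ _ tendsto_const])
    show "(\<lambda>N. cmod (c (Suc N)) * bergman_norm (bergman_kernel b)) \<longlonglongrightarrow> 0"
      by (rule tendsto_mult_left_zero[OF c_lim])
    \<comment> \<open>The selection bound at index \<open>Suc N\<close> concerns the sum over
      \<open>1..<Suc N\<close>, that is, the residual \<open>r N\<close>.\<close>
    show "\<forall>\<^sub>F N in sequentially. cmod (r N b) \<le> cmod (c (Suc N)) * bergman_norm (bergman_kernel b)"
      using selection_residual_bound[OF assms b, of "Suc _"]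
      by (simp add: r_def c_def e_def atLeastLessThanSuc_atLeastAtMost)
  qed simp
  \<comment> \<open>Fatou is applied to \<open>r N - r (N + M)\<close> as \<open>M\<close> grows:
    these are finite blocks of the expansion with squared norm at most
    \<open>S (N + M) - S N\<close>, and they tend to \<open>r N\<close> off the null set
    \<open>range a\<close>.\<close>
  have tail: "(bergman_norm (r N))\<^sup>2 \<le> L - S N" for N
  proof (rule bergman_norm_le_pointwise_limit[OF _ r])
    have diff: "r N z - r (N + M) z = (\<Sum>k = Suc N..N + M. c k * e k z)" for M z
      using sum.ub_add_nat[of 1 N "\<lambda>k. c k * e k z" M] by (simp add: r_def)
    show "(\<lambda>z. r N z - r (N + M) z) \<in> bergman_space" for M
      by (intro bergman_space_diff r)
    show "(bergman_norm (\<lambda>z. r N z - r (N + M) z))\<^sup>2 \<le> L - S N" for M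
    proof -
      have "(bergman_norm (\<lambda>z. r N z - r (N + M) z))\<^sup>2 \<le> (\<Sum>k = Suc N..N + M. (cmod (c k))\<^sup>2)"
        unfolding diff by (intro combination_norm_le on_finite) auto
      also have "\<dots> = S (N + M) - S N"
        using sum.ub_add_nat[of 1 N "\<lambda>k. (cmod (c k))\<^sup>2" M] by (simp add: S_def)
      also have "\<dots> \<le> L - S N" using L(2) by simp
      finally show ?thesis .
    qed
    have "range a \<in> null_sets lborel"
      by (rule countable_imp_null_set_lborel) simp
    then have "AE z in lborel. z \<notin> range a" by (rule AE_not_in)
    then show "AE z in lborel. z \<in> unit_disc \<longrightarrow> (\<lambda>M. r N z - r (N + M) z) \<longlonglongrightarrow> r N z"
    proof eventually_elim
      case (elim z)
      show ?case
      proof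
        assume "z \<in> unit_disc"
        then have "(\<lambda>M. r N z - r (M + N) z) \<longlonglongrightarrow> r N z - 0"
          using elim by (intro tendsto_diff tendsto_const LIMSEQ_ignore_initial_segment pointwise)
        then show "(\<lambda>M. r N z - r (N + M) z) \<longlonglongrightarrow> r N z" by (simp add: add.commute)
      qed
    qed
  qed
  have "(\<lambda>N. L - S N) \<longlonglongrightarrow> L - L" by (intro tendsto_diff tendsto_const L)
  then have upper: "(\<lambda>N. L - S N) \<longlonglongrightarrow> 0" by simp
  have "(\<lambda>N. (bergman_norm (r N))\<^sup>2) \<longlonglongrightarrow> 0"
    by (rule tendsto_sandwich[OF _ _ tendsto_const upper]) (simp_all add: tail)
  then have "(\<lambda>N. sqrt ((bergman_norm (r N))\<^sup>2)) \<longlonglongrightarrow> sqrt 0"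
    by (rule tendsto_real_sqrt)
  then show ?thesis
    by (simp add: bergman_norm_nonneg r_def[abs_def] c_def e_def)
qed

end
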